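(* For all sufficiently large positive integers $n$, $\tau_E(\mathcal{NP}_n) > 3n - 28\sqrt{n}$.
   Context: Let $\mathcal{F}$ be a hypergraph whose vertex set is $E(K_n)$, the edge set of the complete graph on $n$ vertices; its hyperedges are called losing sets. In the unbiased Avoider-Enforcer game on $\mathcal{F}$, two players, Avoider and Enforcer, alternately claim previously unclaimed edges of $K_n$, one edge per turn, with Avoider going first, until all edges are claimed. Enforcer wins if the set of edges claimed by Avoider contains some hyperedge of $\mathcal{F}$ (i.e., Avoider's graph contains a losing set); otherwise Avoider wins. $\tau_E(\mathcal{F})$ denotes the smallest integer $t$ such that Enforcer has a strategy guaranteeing that, whatever Avoider does, Avoider's graph contains a hyperedge of $\mathcal{F}$ after at most $t$ moves (rounds); $\tau_E(\mathcal{F})=\infty$ if Avoider wins the game. $\mathcal{NP}_n$ is the hypergraph on $E(K_n)$ whose hyperedges are the edge sets of all non-planar graphs on the vertex set of $K_n$; thus Avoider loses as soon as his graph becomes non-planar. *)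

theory Defs
  imports "HOL-Analysis.Analysis" "HOL-Library.Extended_Nat"
begin

text \<open>
  Finite simple graphs are given by a vertex set and a set of edges, each edge being
  a two-element set of vertices.
\<close>

definition complete_edges :: "nat \<Rightarrow> nat set set" where
  "complete_edges n = {e. e \<subseteq> {1..n} \<and> card e = 2}"

text \<open>
  Planarity is topological: vertices are distinct points of the plane, edges are simple
  arcs joining their endpoints, an arc meets no vertex other than its endpoints, and two
  different arcs meet only in common endpoints.
\<close>

definition plane_drawing ::
    "'v set \<Rightarrow> 'v set set \<Rightarrow> ('v \<Rightarrow> complex) \<Rightarrow> ('v set \<Rightarrow> real \<Rightarrow> complex) \<Rightarrow> bool" where
  "plane_drawing V E pos crv \<longleftrightarrow>
     inj_on pos V \<and>
     (\<forall>e\<in>E. arc (crv e) \<and>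
             {pathstart (crv e), pathfinish (crv e)} = pos ` e \<and>
             path_image (crv e) \<inter> pos ` V = pos ` e) \<and>
     (\<forall>e\<in>E. \<forall>f\<in>E. e \<noteq> f \<longrightarrow> path_image (crv e) \<inter> path_image (crv f) = pos ` (e \<inter> f))"

definition planar :: "'v set \<Rightarrow> 'v set set \<Rightarrow> bool" where
  "planar V E \<longleftrightarrow> (\<exists>pos crv. plane_drawing V E pos crv)"

definition NP :: "nat \<Rightarrow> nat set set set" where
  "NP n = {H. H \<subseteq> complete_edges n \<and> \<not> planar {1..n} H}"

text \<open>
  A position of the unbiased game on the board \<open>X\<close> is the list of elements claimed so far,
  in order. Avoider moves first, hence makes the moves with even index, and Enforcer
  those with odd index.
\<close>

definition position :: "'a set \<Rightarrow> 'a list \<Rightarrow> bool" where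
  "position X p \<longleftrightarrow> distinct p \<and> set p \<subseteq> X"

definition enforcer_strategy :: "'a set \<Rightarrow> ('a list \<Rightarrow> 'a) \<Rightarrow> bool" where
  "enforcer_strategy X \<sigma> \<longleftrightarrow>
     (\<forall>p. position X p \<and> odd (length p) \<and> set p \<noteq> X \<longrightarrow> \<sigma> p \<in> X - set p)"

definition complete_play :: "'a set \<Rightarrow> ('a list \<Rightarrow> 'a) \<Rightarrow> 'a list \<Rightarrow> bool" where
  "complete_play X \<sigma> p \<longleftrightarrow>
     position X p \<and> set p = X \<and> (\<forall>i<length p. odd i \<longrightarrow> p ! i = \<sigma> (take i p))"

text \<open>The elements claimed by Avoider in his first \<open>t\<close> moves (all his elements if he makes fewer).\<close>

definition avoider_claims :: "nat \<Rightarrow> 'a list \<Rightarrow> 'a set" where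
  "avoider_claims t p = {p ! i | i. i < length p \<and> even i \<and> i < 2 * t}"

definition enforcer_wins_within :: "'a set \<Rightarrow> 'a set set \<Rightarrow> nat \<Rightarrow> bool" where
  "enforcer_wins_within X F t \<longleftrightarrow>
     (\<exists>\<sigma>. enforcer_strategy X \<sigma> \<and>
          (\<forall>p. complete_play X \<sigma> p \<longrightarrow> (\<exists>A\<in>F. A \<subseteq> avoider_claims t p)))"

text \<open>The infimum of the empty set is \<open>\<infinity>\<close>, the value when Avoider wins.\<close>

definition tau_E :: "'a set \<Rightarrow> 'a set set \<Rightarrow> enat" where
  "tau_E X F = (INF t \<in> {t. enforcer_wins_within X F t}. enat t)"

end

theory Submission
  imports Defs
begin

text \<open>
  Avoider uses the vertices 1, 2, 3, 4 as hubs. For every other vertex \<open>v\<close> the edges \<open>v1\<close>, \<open>v2\<close> form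
  a pair, and so do \<open>v3\<close>, \<open>v4\<close>. By a pairing strategy Avoider first claims exactly one edge of each
  of these \<open>2(n - 4)\<close> pairs. This sorts the other vertices into four colour classes, one for each
  choice of a hub from \<open>{1, 2}\<close> and a hub from \<open>{3, 4}\<close>. Then he joins the vertices inside
  the classes into longer and longer paths. He can do so as long as some edge from the end of a path to the
  start of another path of the same colour is free. If \<open>m\<close> paths have the same colour, there are
  at least \<open>m(m - 1)/2\<close> such edges, while fewer than \<open>6n\<close> edges have been claimed so far, so he is stuck
  only when \<open>O(\<surd>n)\<close> paths remain. The final graph is planar: put the hubs at \<open>\<plusminus>1\<close> and \<open>\<plusminus>\<i>\<close>,
  and each colour class on the diagonal of the quadrant between its two hubs, in the order of the paths.
\<close>

section \<open>Plays and the pairing strategy\<close>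

text \<open>\<open>complete_play\<close> without the demand that the board is exhausted: Avoider's
  survival is built up round by round and only later extended to a complete play.\<close>

definition partial_play :: "'a set \<Rightarrow> ('a list \<Rightarrow> 'a) \<Rightarrow> 'a list \<Rightarrow> bool" where
  "partial_play X \<sigma> p \<longleftrightarrow> position X p \<and> (\<forall>i<length p. odd i \<longrightarrow> p ! i = \<sigma> (take i p))"

lemma partial_play_Nil: "partial_play X \<sigma> []"
  by (simp add: partial_play_def position_def)

lemma partial_play_avoider:
  assumes "partial_play X \<sigma> p" "even (length p)" "y \<in> X - set p"
  shows "partial_play X \<sigma> (p @ [y])"
  using assms unfolding partial_play_def position_def
  by (auto simp: nth_append less_Suc_eq)

lemma partial_play_enforcer:
  assumes "enforcer_strategy X \<sigma>" "partial_play X \<sigma> p" "odd (length p)" "set p \<noteq> X"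
  shows "\<sigma> p \<in> X - set p" "partial_play X \<sigma> (p @ [\<sigma> p])"
proof -
  show *: "\<sigma> p \<in> X - set p"
    using assms unfolding enforcer_strategy_def partial_play_def by blast
  then show "partial_play X \<sigma> (p @ [\<sigma> p])"
    using assms unfolding partial_play_def position_def
    by (auto simp: nth_append less_Suc_eq)
qed

text \<open>One move \<open>y\<close> of Avoider followed by the reply of \<open>\<sigma>\<close>.
  The bound on \<open>card X\<close> leaves an element for that reply, so the play always stops with
  Avoider to move.\<close>

lemma partial_play_round:
  assumes "enforcer_strategy X \<sigma>" "partial_play X \<sigma> p" "length p = 2 * t" "y \<in> X - set p"
    "2 * t + 1 < card X"
  obtains z where "partial_play X \<sigma> (p @ [y, z])" "z \<in> X - insert y (set p)"
proof -
  have 1: "partial_play X \<sigma> (p @ [y])"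
    by (rule partial_play_avoider) (use assms in auto)
  have "card (set (p @ [y])) \<le> 2 * t + 1"
    using card_length[of "p @ [y]"] assms(3) by simp
  then have "set (p @ [y]) \<noteq> X"
    using assms(5) by force
  then have "\<sigma> (p @ [y]) \<in> X - set (p @ [y])" "partial_play X \<sigma> ((p @ [y]) @ [\<sigma> (p @ [y])])"
    using partial_play_enforcer[OF assms(1) 1] assms(3) by auto
  then show ?thesis
    using that[of "\<sigma> (p @ [y])"] by simp
qed

text \<open>Winning is defined through complete plays, so a play that has served its purpose must be
  continued to the end. Avoider's remaining moves are arbitrary; the induction is on the number of
  unclaimed elements.\<close>

lemma partial_play_complete:
  assumes "enforcer_strategy X \<sigma>" "finite X" "partial_play X \<sigma> p"
  shows "\<exists>r. complete_play X \<sigma> (p @ r)"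
  using assms(3)
proof (induction "card (X - set p)" arbitrary: p rule: less_induct)
  case less
  have sub: "set p \<subseteq> X"
    using less.prems by (auto simp: partial_play_def position_def)
  show ?case
  proof (cases "set p = X")
    case True
    then show ?thesis
      using less.prems by (intro exI[of _ "[]"]) (auto simp: complete_play_def partial_play_def)
  next
    case False
    obtain y where y: "y \<in> X - set p" "partial_play X \<sigma> (p @ [y])"
    proof (cases "even (length p)")
      case True
      then show ?thesis
        using that partial_play_avoider[OF less.prems] False sub by blast
    next
      case odd: False
      then show ?thesis
        using that partial_play_enforcer[OF assms(1) less.prems] False by blast
    qed
    have "card (X - set (p @ [y])) < card (X - set p)"
      using y(1) assms(2) by (intro psubset_card_mono) auto
    then obtain r where "complete_play X \<sigma> ((p @ [y]) @ r)"
      using less.hyps y(2) by blast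
    then show ?thesis
      by (intro exI[of _ "y # r"]) simp
  qed
qed

section \<open>Avoider's share of a play\<close>

lemma avoider_claims_image:
  "avoider_claims t p = (!) p ` {i. i < length p \<and> even i \<and> i < 2 * t}"
  unfolding avoider_claims_def by blast

lemma avoider_claims_append:
  assumes "2 * t \<le> length p"
  shows "avoider_claims t (p @ r) = avoider_claims t p"
proof -
  have "{i. i < length (p @ r) \<and> even i \<and> i < 2 * t} = {i. i < length p \<and> even i \<and> i < 2 * t}"
    using assms by auto
  then show ?thesis
    unfolding avoider_claims_image by (intro image_cong) (auto simp: nth_append)
qed

lemma avoider_claims_mono: "s \<le> t \<Longrightarrow> avoider_claims s p \<subseteq> avoider_claims t p"
  unfolding avoider_claims_image by (intro image_mono) auto

lemma avoider_claims_round: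
  assumes "length p = 2 * t"
  shows "avoider_claims (Suc t) (p @ [y, z]) = insert y (avoider_claims t p)"
proof -
  have "{i. i < length (p @ [y, z]) \<and> even i \<and> i < 2 * Suc t}
      = insert (2 * t) {i. i < length p \<and> even i \<and> i < 2 * t}"
    using assms by (auto simp: less_Suc_eq)
  moreover have "(!) (p @ [y, z]) ` {i. i < length p \<and> even i \<and> i < 2 * t}
      = (!) p ` {i. i < length p \<and> even i \<and> i < 2 * t}"
    by (intro image_cong) (auto simp: nth_append)
  ultimately show ?thesis
    unfolding avoider_claims_image using assms by (simp only: image_insert) (simp add: nth_append)
qed

text \<open>Avoider does not wait for Enforcer to open a pair: if no open pair has been touched he
  opens one himself. Thus each round settles exactly one pair, and the phase has a fixed length of
  \<open>card Q\<close> rounds.\<close>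

lemma pairing_strategy:
  assumes \<sigma>: "enforcer_strategy X \<sigma>" and fin: "finite Q" and Q: "\<Union>Q \<subseteq> X" "disjoint Q"
    and two: "\<And>q. q \<in> Q \<Longrightarrow> card q = 2" and big: "2 * card Q < card X"
  obtains p where "partial_play X \<sigma> p" "length p = 2 * card Q"
    "avoider_claims (card Q) p \<subseteq> \<Union>Q" "\<And>q. q \<in> Q \<Longrightarrow> is_singleton (avoider_claims (card Q) p \<inter> q)"
proof -
  have same: "q = q'" if "q \<in> Q" "q' \<in> Q" "x \<in> q" "x \<in> q'" for q q' x
    using Q(2) that unfolding disjoint_def by blast
  \<comment> \<open>The pairs in \<open>D\<close> are settled. Before each move of Avoider at most one element of the other pairs
    has been claimed, and he answers with its partner.\<close>
  have "\<exists>p D. partial_play X \<sigma> p \<and> length p = 2 * k \<and> D \<subseteq> Q \<and> card D = k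
      \<and> avoider_claims k p \<subseteq> \<Union>D \<and> (\<forall>q\<in>D. is_singleton (avoider_claims k p \<inter> q))
      \<and> card (set p \<inter> \<Union>(Q - D)) \<le> 1" if "k \<le> card Q" for k
    using that
  proof (induction k)
    case 0
    show ?case
      by (intro exI[of _ "[]"] exI[of _ "{}"]) (auto simp: partial_play_Nil avoider_claims_def)
  next
    case (Suc k)
    from Suc.IH[OF Suc_leD[OF Suc.prems]]
    obtain p D where p: "partial_play X \<sigma> p" "length p = 2 * k" and D: "D \<subseteq> Q" "card D = k"
      and A: "avoider_claims k p \<subseteq> \<Union>D" "\<And>q. q \<in> D \<Longrightarrow> is_singleton (avoider_claims k p \<inter> q)"
      and le1: "card (set p \<inter> \<Union>(Q - D)) \<le> 1"
      by blast
    have "D \<noteq> Q"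
      using D Suc.prems by auto
    have "\<exists>q y. q \<in> Q - D \<and> y \<in> q \<and> y \<notin> set p \<and> set p \<inter> \<Union>(Q - insert q D) = {}"
    proof (cases "set p \<inter> \<Union>(Q - D) = {}")
      case True
      obtain q where "q \<in> Q - D"
        using \<open>D \<noteq> Q\<close> D by blast
      moreover obtain y where "y \<in> q"
        using two[of q] calculation by fastforce
      ultimately show ?thesis
        using True by blast
    next
      case False
      then have "card (set p \<inter> \<Union>(Q - D)) = 1"
        using le1 by (metis List.finite_set card_0_eq finite_Int le_less less_one)
      then obtain x where x: "set p \<inter> \<Union>(Q - D) = {x}"
        by (rule card_1_singletonE)
      then obtain q where q: "q \<in> Q - D" "x \<in> q"
        by blast
      obtain y where y: "y \<in> q" "y \<noteq> x"
        using two[of q] q by (metis DiffD1 card_2_iff insertI1 insert_commute)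
      have "y \<notin> set p"
        using x q y by blast
      moreover have "set p \<inter> \<Union>(Q - insert q D) = {}"
      proof -
        have "x \<notin> \<Union>(Q - insert q D)"
        proof
          assume "x \<in> \<Union>(Q - insert q D)"
          then obtain q' where "q' \<in> Q" "x \<in> q'" "q' \<noteq> q"
            by blast
          then show False
            using q same[of q q' x] by simp
        qed
        moreover have "set p \<inter> \<Union>(Q - insert q D) \<subseteq> {x}"
          unfolding x[symmetric] by blast
        ultimately show ?thesis
          by blast
      qed
      ultimately show ?thesis
        using q(1) y(1) by blast
    qed
    then obtain q y where q: "q \<in> Q - D" "y \<in> q" "y \<notin> set p" "set p \<inter> \<Union>(Q - insert q D) = {}"
      by blast
    have yX: "y \<in> X - set p"
      using q Q by blast
    have "2 * k + 1 < card X"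
      using big Suc.prems by linarith
    then obtain z where z: "partial_play X \<sigma> (p @ [y, z])"
      using partial_play_round[OF \<sigma> p yX] by blast
    have dis: "q \<inter> \<Union>D = {}"
      using q(1) D(1) same by blast
    have y': "y \<notin> \<Union>(Q - insert q D)"
    proof
      assume "y \<in> \<Union>(Q - insert q D)"
      then obtain q' where "q' \<in> Q" "y \<in> q'" "q' \<noteq> q"
        by blast
      then show False
        using q(1,2) same[of q q' y] by simp
    qed
    \<comment> \<open>\<open>y\<close> belongs only to the pair \<open>q\<close>, which is now
      settled. Hence Enforcer's reply \<open>z\<close> is the only claimed element that can lie in
      an open pair, which restores the invariant.\<close>
    have "set (p @ [y, z]) \<inter> \<Union>(Q - insert q D) \<subseteq> {z}"
      using q(4) y' by auto
    then have le: "card (set (p @ [y, z]) \<inter> \<Union>(Q - insert q D)) \<le> 1"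
      using card_mono[of "{z}"] by fastforce
    have new: "avoider_claims (Suc k) (p @ [y, z]) = insert y (avoider_claims k p)"
      by (rule avoider_claims_round) (rule p)
    have "is_singleton (insert y (avoider_claims k p) \<inter> r)" if "r \<in> insert q D" for r
    proof (cases "r = q")
      case True
      then have "insert y (avoider_claims k p) \<inter> r = {y}"
        using A(1) dis q(2) by blast
      then show ?thesis
        by simp
    next
      case False
      then have "insert y (avoider_claims k p) \<inter> r = avoider_claims k p \<inter> r"
        using that same[of q r y] D(1) q(1,2) by auto
      then show ?thesis
        using A(2) that False by simp
    qed
    moreover have "card (insert q D) = Suc k"
      using D q fin finite_subset by fastforce
    ultimately show ?case
      using z le p D q A(1) new
      by (intro exI[of _ "p @ [y, z]"] exI[of _ "insert q D"]) auto
  qed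
  from this[of "card Q"] obtain p D where p: "partial_play X \<sigma> p" "length p = 2 * card Q" "D \<subseteq> Q"
    "card D = card Q" "avoider_claims (card Q) p \<subseteq> \<Union>D"
    "\<forall>q\<in>D. is_singleton (avoider_claims (card Q) p \<inter> q)"
    by auto
  then have "D = Q"
    using fin card_subset_eq by blast
  then show ?thesis
    using that p by blast
qed

section \<open>Joining paths\<close>

text \<open>Each list is a path traversed in order. Consecutive vertices are described by a
  factorisation instead of by indices, because a factorisation survives prepending and appending
  another path.\<close>

definition path_edges :: "'a list list \<Rightarrow> 'a set set" where
  "path_edges L = {{x, y} | x y. \<exists>us vs. us @ x # y # vs \<in> set L}"

lemma path_edgesI: "us @ x # y # vs \<in> set L \<Longrightarrow> {x, y} \<in> path_edges L"
  unfolding path_edges_def by blast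

text \<open>\<open>L'\<close> arises from \<open>L\<close> by replacing \<open>p\<close> and
  \<open>q\<close> with \<open>p @ q\<close>. Its concatenation is a permutation of the old one, so
  an equation of multisets transfers distinctness and the vertex set. An inclusion for the edges
  suffices, since planarity passes to subgraphs.\<close>

lemma join_paths:
  assumes "distinct (concat L)" "[] \<notin> set L" "p \<in> set L" "q \<in> set L" "p \<noteq> q"
  obtains L' where "length L = Suc (length L')" "distinct (concat L')" "[] \<notin> set L'"
    "set (concat L') = set (concat L)" "set L' \<subseteq> insert (p @ q) (set L)"
    "insert {last p, hd q} (path_edges L) \<subseteq> path_edges L'"
proof -
  define M where "M = remove1 q (remove1 p L)"
  define L' where "L' = (p @ q) # M"
  have q': "q \<in> set (remove1 p L)"
    using assms by simp
  have "mset L = add_mset p (mset (remove1 p L))"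
    using insert_DiffM[of p "mset L"] assms(3) by simp
  moreover have "mset (remove1 p L) = add_mset q (mset M)"
    using insert_DiffM[of q "mset (remove1 p L)"] q' unfolding M_def set_mset_mset[symmetric]
    by (metis mset_remove1)
  ultimately have mset: "mset L = mset (p # q # M)"
    by simp
  have "mset (concat L) = mset (concat (p # q # M))"
    unfolding mset_concat using mset by (metis mset_map sum_mset_sum_list)
  then have mc: "mset (concat L') = mset (concat L)"
    by (simp add: L'_def)
  have set: "set L = insert p (insert q (set M))"
    using mset_eq_setD[OF mset] by simp
  have len: "length L = Suc (length L')"
    using mset_eq_length[OF mset] by (simp add: L'_def)
  \<comment> \<open>This exhibits the junction: the new edge joins the last vertex of
    \<open>p\<close> to the first vertex of \<open>q\<close>.\<close>
  have pq: "p @ q = butlast p @ last p # hd q # tl q"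
    using assms by (metis append.assoc append_Cons append_Nil append_butlast_last_id list.collapse)
  have old: "{x, y} \<in> path_edges L'" if edge: "us @ x # y # vs \<in> set L" for us vs x y
  proof -
    consider "us @ x # y # vs = p" | "us @ x # y # vs = q" | "us @ x # y # vs \<in> set M"
      using edge unfolding set by blast
    then show ?thesis
    proof cases
      case 1
      then have "us @ x # y # (vs @ q) \<in> set L'"
        by (simp add: L'_def flip: 1)
      then show ?thesis
        by (rule path_edgesI)
    next
      case 2
      then have "(p @ us) @ x # y # vs \<in> set L'"
        by (simp add: L'_def flip: 2)
      then show ?thesis
        by (rule path_edgesI)
    next
      case 3
      then have "us @ x # y # vs \<in> set L'"
        by (simp add: L'_def)
      then show ?thesis
        by (rule path_edgesI)
    qed
  qed
  have "{last p, hd q} \<in> path_edges L'"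
    by (rule path_edgesI[of "butlast p" _ _ "tl q"]) (simp add: L'_def flip: pq)
  then have "insert {last p, hd q} (path_edges L) \<subseteq> path_edges L'"
    using old by (auto simp: path_edges_def[of L])
  moreover have "distinct (concat L')" "set (concat L') = set (concat L)"
    using mset_eq_imp_distinct_iff[OF mc] mset_eq_setD[OF mc] assms(1) by auto
  moreover have "[] \<notin> set L'" "set L' \<subseteq> insert (p @ q) (set L)"
    using assms set by (auto simp: L'_def)
  ultimately show ?thesis
    using that[of L'] len by simp
qed

text \<open>A count of ordered pairs. Since the paths are nonempty and disjoint,
  \<open>(last p, hd q)\<close> determines \<open>(p, q)\<close>, so there are
  \<open>card C * (card C - 1)\<close> candidate joins with a direction. A claimed edge blocks at
  most two of them, one for each of its orientations.\<close>

lemma exists_free_join: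
  assumes L: "distinct (concat L)" "[] \<notin> set L" and C: "C \<subseteq> set L" and B: "finite B"
    and big: "2 * card B < card C * (card C - 1)"
  shows "\<exists>p\<in>C. \<exists>q\<in>C. p \<noteq> q \<and> {last p, hd q} \<notin> B"
proof (rule ccontr)
  assume neg: "\<not> ?thesis"
  have same: "p = q" if "p \<in> set L" "q \<in> set L" "x \<in> set p" "x \<in> set q" for p q x
    using L(1) that unfolding distinct_concat_iff by blast
  let ?P = "Sigma C (\<lambda>p. C - {p})"
  have "finite C"
    using finite_subset[OF C] by simp
  then have cardP: "card ?P = card C * (card C - 1)"
    by (simp add: card_SigmaI)
  have ends: "last p \<in> set p" "hd p \<in> set p" if "p \<in> C" for p
    using that L(2) C by (metis hd_in_set last_in_set subsetD)+
  have inj: "inj_on (\<lambda>(p, q). (last p, hd q)) ?P"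
  proof (rule inj_onI)
    fix a b
    assume ab: "a \<in> ?P" "b \<in> ?P" "(\<lambda>(p, q). (last p, hd q)) a = (\<lambda>(p, q). (last p, hd q)) b"
    obtain p q p' q' where eq: "a = (p, q)" "b = (p', q')"
      by fastforce
    then have *: "p \<in> C" "p' \<in> C" "q \<in> C" "q' \<in> C" "last p = last p'" "hd q = hd q'"
      using ab by auto
    have "last p \<in> set p" "last p' \<in> set p'" "hd q \<in> set q" "hd q' \<in> set q'"
      using * ends by blast+
    moreover have "p \<in> set L" "p' \<in> set L" "q \<in> set L" "q' \<in> set L"
      using * C by auto
    ultimately show "a = b"
      using eq * same[of p p' "last p"] same[of q q' "hd q"] by simp
  qed
  have "(\<lambda>(p, q). (last p, hd q)) ` ?P \<subseteq> (\<Union>e\<in>B. {(x, y). {x, y} = e})"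
  proof
    fix a
    assume "a \<in> (\<lambda>(p, q). (last p, hd q)) ` ?P"
    then obtain p q where "p \<in> C" "q \<in> C" "p \<noteq> q" "a = (last p, hd q)"
      by auto
    then show "a \<in> (\<Union>e\<in>B. {(x, y). {x, y} = e})"
      using neg by auto
  qed
  moreover have fin2: "finite {(x, y). {x, y} = e} \<and> card {(x, y). {x, y} = e} \<le> 2" for e :: "'a set"
  proof (cases "\<exists>u w. e = {u, w}")
    case True
    then obtain u w where "e = {u, w}"
      by blast
    then have sub: "{(x, y). {x, y} = e} \<subseteq> {(u, w), (w, u)}"
      by (auto simp: doubleton_eq_iff)
    moreover have "card {(u, w), (w, u)} \<le> 2"
      using card_length[of "[(u, w), (w, u)]"] by simp
    ultimately show ?thesis
      using finite_subset[OF sub] card_mono[OF _ sub] by simp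
  next
    case False
    then have "{(x, y). {x, y} = e} = {}"
      by blast
    then show ?thesis
      by simp
  qed
  moreover have "finite (\<Union>e\<in>B. {(x, y). {x, y} = e})"
    using B fin2 by simp
  ultimately have "card ?P \<le> card (\<Union>e\<in>B. {(x, y). {x, y} = e})"
    unfolding card_image[OF inj, symmetric] by (intro card_mono)
  also have "\<dots> \<le> (\<Sum>e\<in>B. card {(x, y). {x, y} = e})"
    by (rule card_UN_le) (rule B)
  also have "\<dots> \<le> (\<Sum>e\<in>B. 2)"
    by (rule sum_mono) (use fin2 in blast)
  finally show False
    using big cardP by simp
qed

section \<open>Plane drawings\<close>

lemma planar_subset:
  assumes "planar V E" "E' \<subseteq> E"
  shows "planar V E'"
proof -
  obtain pos crv where "plane_drawing V E pos crv"
    using assms(1) unfolding planar_def by blast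
  then have "plane_drawing V E' pos crv"
    unfolding plane_drawing_def using subsetD[OF assms(2)] by simp
  then show ?thesis
    unfolding planar_def by blast
qed

text \<open>Reduces a topological drawing to statements about segments. Convex hulls describe a
  segment without choosing an order of its ends, which suits edges that are sets.\<close>

lemma straight_line_planar:
  fixes pos :: "'v \<Rightarrow> complex"
  assumes inj: "inj_on pos V" and E: "\<And>e. e \<in> E \<Longrightarrow> e \<subseteq> V \<and> card e = 2"
    and vert: "\<And>e v. e \<in> E \<Longrightarrow> v \<in> V \<Longrightarrow> pos v \<in> convex hull (pos ` e) \<Longrightarrow> v \<in> e"
    and cross: "\<And>e f z. e \<in> E \<Longrightarrow> f \<in> E \<Longrightarrow> e \<noteq> f \<Longrightarrow> z \<in> convex hull (pos ` e) \<Longrightarrow>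
       z \<in> convex hull (pos ` f) \<Longrightarrow> z \<in> pos ` (e \<inter> f)"
  shows "planar V E"
proof -
  \<comment> \<open>A parametrised arc needs a start and an end, so an orientation
    \<open>h e\<close> is fixed for every edge; the image of the arc does not depend on it.\<close>
  have "\<forall>e\<in>E. \<exists>uw. e = {fst uw, snd uw} \<and> fst uw \<noteq> snd uw"
    using E by (metis card_2_iff fst_conv snd_conv)
  then obtain h where h: "\<And>e. e \<in> E \<Longrightarrow> e = {fst (h e), snd (h e)} \<and> fst (h e) \<noteq> snd (h e)"
    by metis
  define crv where "crv e = linepath (pos (fst (h e))) (pos (snd (h e)))" for e
  have img: "pos ` e = {pos (fst (h e)), pos (snd (h e))}" if "e \<in> E" for e
    using h[OF that] by (metis image_empty image_insert)
  have hull: "path_image (crv e) = convex hull (pos ` e)" if "e \<in> E" for e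
    by (simp add: img[OF that] crv_def segment_convex_hull)
  have in_hull: "pos v \<in> convex hull (pos ` e)" if "v \<in> e" for v e
    using that hull_inc[of "pos v" "pos ` e"] by blast
  have "arc (crv e)" if "e \<in> E" for e
  proof -
    have "fst (h e) \<in> V" "snd (h e) \<in> V" "fst (h e) \<noteq> snd (h e)"
      using h[OF that] E[OF that] by auto
    then show ?thesis
      using inj unfolding crv_def by (metis arc_linepath inj_onD)
  qed
  moreover have "path_image (crv e) \<inter> pos ` V = pos ` e" if "e \<in> E" for e
    unfolding hull[OF that] using vert[OF that] E[OF that] in_hull by blast
  moreover have "path_image (crv e) \<inter> path_image (crv f) = pos ` (e \<inter> f)"
    if "e \<in> E" "f \<in> E" "e \<noteq> f" for e f
    unfolding hull[OF that(1)] hull[OF that(2)] using cross[OF that] in_hull by blast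
  ultimately have "plane_drawing V E pos crv"
    unfolding plane_drawing_def using inj by (auto simp: img crv_def)
  then show ?thesis
    unfolding planar_def by blast
qed

text \<open>The signs \<open>s\<close> and \<open>r\<close> reflect the quadrant onto the first one:
  put X = \<open>s * Re z\<close> and Y = \<open>r * Im z\<close>. The spoke then runs from (t, t)
  to (1, 0), and X - Y is exactly its parameter \<open>u\<close>. Eliminating \<open>u\<close> gives
  Y = t (1 - (X - Y)), from which \<open>t\<close> can be recovered at every point except the
  hub.\<close>

lemma horizontal_spoke:
  assumes z: "z \<in> closed_segment (Complex (s * t) (r * t)) (Complex s 0)"
    and s: "s \<in> {1, -1}" "r \<in> {1, -1}" and t: "0 < (t::real)"
  shows "z = Complex s 0 \<or> (0 < s * Re z \<and> 0 < r * Im z \<and> r * Im z \<le> s * Re z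
    \<and> s * Re z - r * Im z < 1 \<and> r * Im z = t * (1 - (s * Re z - r * Im z)))"
proof -
  obtain u where u: "0 \<le> u" "u \<le> 1"
    and "z = (1 - u) *\<^sub>R Complex (s * t) (r * t) + u *\<^sub>R Complex s 0"
    using z by (auto simp: in_segment)
  then have z': "Re z = (1 - u) * (s * t) + u * s" "Im z = (1 - u) * (r * t)"
    by auto
  have XY: "s * Re z = (1 - u) * t + u" "r * Im z = (1 - u) * t"
    using s unfolding z' by auto
  show ?thesis
  proof (cases "u = 1")
    case True
    then show ?thesis
      using z' by (auto simp: complex_eq_iff)
  next
    case False
    then have "0 < (1 - u) * t"
      using u t by simp
    then show ?thesis
      unfolding XY using u False by (auto simp: algebra_simps)
  qed
qed

text \<open>The mirror image of \<open>horizontal_spoke\<close> in the diagonal.\<close>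

lemma vertical_spoke:
  assumes z: "z \<in> closed_segment (Complex (s * t) (r * t)) (Complex 0 r)"
    and s: "s \<in> {1, -1}" "r \<in> {1, -1}" and t: "0 < (t::real)"
  shows "z = Complex 0 r \<or> (0 < s * Re z \<and> 0 < r * Im z \<and> s * Re z \<le> r * Im z
    \<and> r * Im z - s * Re z < 1 \<and> s * Re z = t * (1 - (r * Im z - s * Re z)))"
proof -
  obtain u where u: "0 \<le> u" "u \<le> 1"
    and "z = (1 - u) *\<^sub>R Complex (s * t) (r * t) + u *\<^sub>R Complex 0 r"
    using z by (auto simp: in_segment)
  then have z': "Im z = (1 - u) * (r * t) + u * r" "Re z = (1 - u) * (s * t)"
    by auto
  have XY: "r * Im z = (1 - u) * t + u" "s * Re z = (1 - u) * t"
    using s unfolding z' by auto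
  show ?thesis
  proof (cases "u = 1")
    case True
    then show ?thesis
      using z' by (auto simp: complex_eq_iff)
  next
    case False
    then have "0 < (1 - u) * t"
      using u t by simp
    then show ?thesis
      unfolding XY using u False by (auto simp: algebra_simps)
  qed
qed

lemma diagonal_segment:
  assumes z: "z \<in> closed_segment (Complex (s * t) (r * t)) (Complex (s * (t + 1)) (r * (t + 1)))"
    and s: "s \<in> {1, -1}" "r \<in> {1, -1}" and t: "0 < (t::real)"
  shows "0 < s * Re z \<and> 0 < r * Im z \<and> s * Re z = r * Im z \<and> t \<le> s * Re z \<and> s * Re z \<le> t + 1"
proof -
  obtain u where u: "0 \<le> u" "u \<le> 1"
    and "z = (1 - u) *\<^sub>R Complex (s * t) (r * t) + u *\<^sub>R Complex (s * (t + 1)) (r * (t + 1))"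
    using z by (auto simp: in_segment)
  then have z': "Re z = (1 - u) * (s * t) + u * (s * (t + 1))" "Im z = (1 - u) * (r * t) + u * (r * (t + 1))"
    by auto
  have "s * Re z = t + u" "r * Im z = t + u"
    using s unfolding z' by (auto simp: algebra_simps)
  then show ?thesis
    using u t by auto
qed

lemma sign_eq:
  fixes s s' x :: real
  assumes "s \<in> {1, -1}" "s' \<in> {1, -1}" "0 < s * x" "0 < s' * x"
  shows "s = s'"
  using assms by auto

text \<open>In each open quadrant the horizontal spokes lie on or below the diagonal (after
  reflection), the vertical spokes on or above it, and the path edges on it. Edges of different
  kinds can thus meet only on the diagonal, and a spoke reaches the diagonal only at its own vertex.
  Consecutive levels leave no room for a further vertex inside a path edge.\<close>

lemma hub_graph_planar:
  fixes \<alpha> \<beta> \<tau> :: "nat \<Rightarrow> nat"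
  assumes \<alpha>: "\<And>v. \<alpha> v \<in> {1, 2}" and \<beta>: "\<And>v. \<beta> v \<in> {3, 4}" and n: "4 \<le> n"
    and \<tau>: "inj_on \<tau> {5..n}" "\<And>v. v \<in> {5..n} \<Longrightarrow> 0 < \<tau> v"
  shows "planar {1..n} ({{v, \<alpha> v} | v. v \<in> {5..n}} \<union> {{v, \<beta> v} | v. v \<in> {5..n}}
     \<union> {{v, w} | v w. v \<in> {5..n} \<and> w \<in> {5..n} \<and> \<alpha> v = \<alpha> w \<and> \<beta> v = \<beta> w \<and> \<tau> w = Suc (\<tau> v)})"
    (is "planar _ (?H \<union> ?V \<union> ?P)")
proof -
  define s where "s v = (if \<alpha> v = 1 then 1 else -1 :: real)" for v
  define r where "r v = (if \<beta> v = 3 then 1 else -1 :: real)" for v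
  \<comment> \<open>The value \<open>\<tau> v\<close> is the distance of \<open>v\<close> from both axes. Since a hub is off the diagonal, spokes
    from one hub to different levels of the diagonal meet only in the hub.\<close>
  define pos where "pos v = (if v = 1 then 1 else if v = 2 then -1 else if v = 3 then \<i> else if v = 4 then -\<i>
     else Complex (s v * real (\<tau> v)) (r v * real (\<tau> v)))" for v
  have sr: "s v \<in> {1, -1}" "r v \<in> {1, -1}" for v
    by (auto simp: s_def r_def)
  have s_eq: "\<alpha> v = \<alpha> w" if "s v = s w" for v w
    using that \<alpha>[of v] \<alpha>[of w] by (auto simp: s_def split: if_splits)
  have r_eq: "\<beta> v = \<beta> w" if "r v = r w" for v w
    using that \<beta>[of v] \<beta>[of w] by (auto simp: r_def split: if_splits)
  have pos\<alpha>: "pos (\<alpha> v) = Complex (s v) 0" and pos\<beta>: "pos (\<beta> v) = Complex 0 (r v)" for v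
    using \<alpha>[of v] \<beta>[of v] by (auto simp: pos_def s_def r_def complex_eq_iff)
  have posW: "pos v = Complex (s v * real (\<tau> v)) (r v * real (\<tau> v))" if "v \<in> {5..n}" for v
    using that by (auto simp: pos_def)
  \<comment> \<open>A point off both axes lies in a single quadrant, so edges that share such a
    point belong to the same colour.\<close>
  have same_sign: "s v = s w \<and> r v = r w"
    if "0 < s v * Re z" "0 < r v * Im z" "0 < s w * Re z" "0 < r w * Im z" for v w z
    using that sign_eq[OF sr(1) sr(1), of v "Re z" w] sign_eq[OF sr(2) sr(2), of v "Im z" w] by simp
  have H: "z = pos (\<alpha> v) \<or> (0 < s v * Re z \<and> 0 < r v * Im z \<and> r v * Im z \<le> s v * Re z
    \<and> s v * Re z - r v * Im z < 1 \<and> r v * Im z = \<tau> v * (1 - (s v * Re z - r v * Im z)))"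
    if "v \<in> {5..n}" "z \<in> convex hull (pos ` {v, \<alpha> v})" for v z
    using horizontal_spoke[of z "s v" "\<tau> v" "r v"] that \<tau>(2)[of v] sr[of v]
    by (simp add: posW pos\<alpha> segment_convex_hull)
  have V: "z = pos (\<beta> v) \<or> (0 < s v * Re z \<and> 0 < r v * Im z \<and> s v * Re z \<le> r v * Im z
    \<and> r v * Im z - s v * Re z < 1 \<and> s v * Re z = \<tau> v * (1 - (r v * Im z - s v * Re z)))"
    if "v \<in> {5..n}" "z \<in> convex hull (pos ` {v, \<beta> v})" for v z
    using vertical_spoke[of z "s v" "\<tau> v" "r v"] that \<tau>(2)[of v] sr[of v]
    by (simp add: posW pos\<beta> segment_convex_hull)
  have P: "0 < s v * Re z \<and> 0 < r v * Im z \<and> s v * Re z = r v * Im z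
     \<and> \<tau> v \<le> s v * Re z \<and> s v * Re z \<le> \<tau> w"
    if "v \<in> {5..n}" "w \<in> {5..n}" "\<alpha> v = \<alpha> w" "\<beta> v = \<beta> w" "\<tau> w = Suc (\<tau> v)"
      "z \<in> convex hull (pos ` {v, w})" for v w z
  proof -
    have "s w = s v" "r w = r v"
      using that by (auto simp: s_def r_def)
    then show ?thesis
      using diagonal_segment[of z "s v" "\<tau> v" "r v"] that \<tau>(2)[of v] sr[of v]
      by (simp add: posW segment_convex_hull add.commute)
  qed
  have on_axis: "Re (pos (\<alpha> v)) \<noteq> 0" "Im (pos (\<alpha> v)) = 0" "Re (pos (\<beta> v)) = 0" "Im (pos (\<beta> v)) \<noteq> 0" for v
    using sr[of v] by (auto simp: pos\<alpha> pos\<beta>)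
  have level: "z = pos v" if "v \<in> {5..n}" "s v * Re z = r v * Im z" "s v * Re z = \<tau> v" for v z
    using that sr[of v] by (auto simp: posW complex_eq_iff)
  have HH: "z \<in> pos ` ({v, \<alpha> v} \<inter> {w, \<alpha> w})"
    if "v \<in> {5..n}" "w \<in> {5..n}" "{v, \<alpha> v} \<noteq> {w, \<alpha> w}"
      "z \<in> convex hull (pos ` {v, \<alpha> v})" "z \<in> convex hull (pos ` {w, \<alpha> w})" for v w z
  proof (cases "z = pos (\<alpha> v) \<or> z = pos (\<alpha> w)")
    case True
    then have "Im z = 0"
      using on_axis by blast
    then have "z = pos (\<alpha> v)" "z = pos (\<alpha> w)"
      using H[OF that(1,4)] H[OF that(2,5)] by simp_all
    then show ?thesis
      using s_eq[of v w] pos\<alpha> by (metis IntI complex.inject imageI insert_iff)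
  next
    case False
    then have h: "0 < s v * Re z" "0 < r v * Im z" "s v * Re z - r v * Im z < 1"
        "r v * Im z = \<tau> v * (1 - (s v * Re z - r v * Im z))"
        "0 < s w * Re z" "0 < r w * Im z" "r w * Im z = \<tau> w * (1 - (s w * Re z - r w * Im z))"
      using H[OF that(1,4)] H[OF that(2,5)] by auto
    then have eq: "s v = s w" "r v = r w"
      using same_sign by blast+
    \<comment> \<open>Both spoke equations now have the same factor 1 - (X - Y), which is positive
      away from the hub and can be cancelled.\<close>
    have "\<tau> v = \<tau> w"
      using h unfolding eq by (metis diff_gt_0_iff_gt mult_cancel_right of_nat_eq_iff order_less_irrefl)
    then have "v = w"
      using \<tau>(1) that by (auto dest: inj_onD)
    then show ?thesis
      using that by simp
  qed
  have VV: "z \<in> pos ` ({v, \<beta> v} \<inter> {w, \<beta> w})"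
    if "v \<in> {5..n}" "w \<in> {5..n}" "{v, \<beta> v} \<noteq> {w, \<beta> w}"
      "z \<in> convex hull (pos ` {v, \<beta> v})" "z \<in> convex hull (pos ` {w, \<beta> w})" for v w z
  proof (cases "z = pos (\<beta> v) \<or> z = pos (\<beta> w)")
    case True
    then have "Re z = 0"
      using on_axis by blast
    then have "z = pos (\<beta> v)" "z = pos (\<beta> w)"
      using V[OF that(1,4)] V[OF that(2,5)] by simp_all
    then show ?thesis
      using r_eq[of v w] pos\<beta> by (metis IntI complex.inject imageI insert_iff)
  next
    case False
    then have h: "0 < s v * Re z" "0 < r v * Im z" "r v * Im z - s v * Re z < 1"
        "s v * Re z = \<tau> v * (1 - (r v * Im z - s v * Re z))"
        "0 < s w * Re z" "0 < r w * Im z" "s w * Re z = \<tau> w * (1 - (r w * Im z - s w * Re z))"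
      using V[OF that(1,4)] V[OF that(2,5)] by auto
    then have eq: "s v = s w" "r v = r w"
      using same_sign by blast+
    have "\<tau> v = \<tau> w"
      using h unfolding eq by (metis diff_gt_0_iff_gt mult_cancel_right of_nat_eq_iff order_less_irrefl)
    then have "v = w"
      using \<tau>(1) that by (auto dest: inj_onD)
    then show ?thesis
      using that by simp
  qed
  have HV: "z \<in> pos ` ({v, \<alpha> v} \<inter> {w, \<beta> w})"
    if "v \<in> {5..n}" "w \<in> {5..n}"
      "z \<in> convex hull (pos ` {v, \<alpha> v})" "z \<in> convex hull (pos ` {w, \<beta> w})" for v w z
  proof -
    have "Re z \<noteq> 0"
      using H[OF that(1,3)] on_axis(1) by auto
    moreover have "Im z \<noteq> 0"
      using V[OF that(2,4)] on_axis(4) by auto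
    ultimately have nz: "z \<noteq> pos (\<alpha> v)" "z \<noteq> pos (\<beta> w)"
      using on_axis(2,3) by blast+
    have h: "0 < s v * Re z" "0 < r v * Im z" "r v * Im z \<le> s v * Re z"
        "r v * Im z = \<tau> v * (1 - (s v * Re z - r v * Im z))"
        "0 < s w * Re z" "0 < r w * Im z" "s w * Re z \<le> r w * Im z"
        "s w * Re z = \<tau> w * (1 - (r w * Im z - s w * Re z))"
      using H[OF that(1,3)] V[OF that(2,4)] nz by simp_all
    then have eq: "s w = s v" "r w = r v"
      using same_sign by blast+
    \<comment> \<open>The two inequalities place \<open>z\<close> on the diagonal. There X - Y = 0,
      so each spoke equation reduces to X being the level of its vertex.\<close>
    have "s v * Re z = r v * Im z"
      using h unfolding eq by linarith
    then have *: "s v * Re z = r v * Im z" "s v * Re z = \<tau> v" "\<tau> v = \<tau> w"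
      using h unfolding eq by auto
    then have "v = w"
      using \<tau>(1) that by (auto dest: inj_onD)
    then show ?thesis
      using level[OF that(1) *(1,2)] by blast
  qed
  \<comment> \<open>Levels are integers, so none lies strictly between two consecutive ones.\<close>
  have between: "v = x \<or> v = y" if "v \<in> {5..n}" "x \<in> {5..n}" "y \<in> {5..n}" "\<tau> y = Suc (\<tau> x)"
     "real (\<tau> x) \<le> \<tau> v" "real (\<tau> v) \<le> \<tau> y" for v x y
  proof -
    have "\<tau> v = \<tau> x \<or> \<tau> v = \<tau> y"
      using that by linarith
    then show ?thesis
      using inj_onD[OF \<tau>(1)] that(1-3) by metis
  qed
  have HP: "z \<in> pos ` ({v, \<alpha> v} \<inter> {x, y})"
    if "v \<in> {5..n}" "z \<in> convex hull (pos ` {v, \<alpha> v})"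
      "x \<in> {5..n}" "y \<in> {5..n}" "\<alpha> x = \<alpha> y" "\<beta> x = \<beta> y" "\<tau> y = Suc (\<tau> x)"
      "z \<in> convex hull (pos ` {x, y})" for v x y z
  proof -
    note p = P[OF that(3-8)]
    have nz: "z \<noteq> pos (\<alpha> v)"
      using p on_axis(2)[of v] by auto
    have h: "0 < s v * Re z" "0 < r v * Im z" "r v * Im z = \<tau> v * (1 - (s v * Re z - r v * Im z))"
      using H[OF that(1,2)] nz by simp_all
    then have eq: "s x = s v" "r x = r v"
      using same_sign p by blast+
    have *: "s v * Re z = r v * Im z" "s v * Re z = \<tau> v"
      using h p unfolding eq by auto
    have "v = x \<or> v = y"
      using p * unfolding eq by (intro between that) auto
    then show ?thesis
      using level[OF that(1) *] by blast
  qed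
  have VP: "z \<in> pos ` ({v, \<beta> v} \<inter> {x, y})"
    if "v \<in> {5..n}" "z \<in> convex hull (pos ` {v, \<beta> v})"
      "x \<in> {5..n}" "y \<in> {5..n}" "\<alpha> x = \<alpha> y" "\<beta> x = \<beta> y" "\<tau> y = Suc (\<tau> x)"
      "z \<in> convex hull (pos ` {x, y})" for v x y z
  proof -
    note p = P[OF that(3-8)]
    have nz: "z \<noteq> pos (\<beta> v)"
      using p on_axis(3)[of v] by auto
    have h: "0 < s v * Re z" "0 < r v * Im z" "s v * Re z = \<tau> v * (1 - (r v * Im z - s v * Re z))"
      using V[OF that(1,2)] nz by simp_all
    then have eq: "s x = s v" "r x = r v"
      using same_sign p by blast+
    have *: "s v * Re z = r v * Im z" "s v * Re z = \<tau> v"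
      using h p unfolding eq by auto
    have "v = x \<or> v = y"
      using p * unfolding eq by (intro between that) auto
    then show ?thesis
      using level[OF that(1) *] by blast
  qed
  have PP: "z \<in> pos ` ({v, w} \<inter> {x, y})"
    if "v \<in> {5..n}" "w \<in> {5..n}" "\<alpha> v = \<alpha> w" "\<beta> v = \<beta> w" "\<tau> w = Suc (\<tau> v)"
      "z \<in> convex hull (pos ` {v, w})"
      "x \<in> {5..n}" "y \<in> {5..n}" "\<alpha> x = \<alpha> y" "\<beta> x = \<beta> y" "\<tau> y = Suc (\<tau> x)"
      "z \<in> convex hull (pos ` {x, y})" "{v, w} \<noteq> {x, y}" for v w x y z
  proof -
    note p = P[OF that(1-6)] and q = P[OF that(7-12)]
    have eq: "s x = s v" "r x = r v"
      using same_sign p q by blast+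
    have eq': "s w = s v" "r w = r v" "s y = s v" "r y = r v"
      using eq that by (auto simp: s_def r_def)
    \<comment> \<open>Two different path edges in one quadrant occupy different unit intervals of
      levels. If these intervals meet, the top of one is the bottom of the other, and
      \<open>z\<close> is the vertex there.\<close>
    have "\<tau> v \<noteq> \<tau> x"
      using that \<tau>(1) by (metis inj_onD)
    moreover have "real (\<tau> v) \<le> \<tau> y" "real (\<tau> x) \<le> \<tau> w"
      using p q unfolding eq by linarith+
    ultimately have "\<tau> y = \<tau> v \<or> \<tau> w = \<tau> x"
      using that(5,11) by linarith
    then consider "\<tau> y = \<tau> v" | "\<tau> w = \<tau> x"
      by blast
    then show ?thesis
    proof cases
      case 1
      then have "y = v"
        using that \<tau>(1) by (metis inj_onD)
      moreover have "z = pos v"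
        using p q 1 unfolding eq by (intro level that(1)) auto
      ultimately show ?thesis
        by blast
    next
      case 2
      then have "w = x"
        using that \<tau>(1) by (metis inj_onD)
      moreover have "z = pos x"
        using p q 2 unfolding eq by (intro level that(7)) (auto simp: eq)
      ultimately show ?thesis
        by blast
    qed
  qed
  have cross: "z \<in> pos ` (e \<inter> f)" if "e \<in> ?H \<union> ?V \<union> ?P" "f \<in> ?H \<union> ?V \<union> ?P" "e \<noteq> f"
    "z \<in> convex hull (pos ` e)" "z \<in> convex hull (pos ` f)" for e f z
  proof -
    note crossing = that
    \<comment> \<open>Mixed crossings are settled for one order of the two kinds; the other order
      follows by exchanging \<open>e\<close> and \<open>f\<close>.\<close>
    have cases: "z \<in> pos ` (e \<inter> f)" if ef: "e \<in> ?H \<and> f \<in> ?V \<or> (e \<in> ?H \<or> e \<in> ?V) \<and> f \<in> ?P"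
      and zef: "z \<in> convex hull (pos ` e)" "z \<in> convex hull (pos ` f)" for e f
    proof -
      consider "e \<in> ?H" "f \<in> ?V" | "e \<in> ?H" "f \<in> ?P" | "e \<in> ?V" "f \<in> ?P"
        using ef by argo
      then show ?thesis
      proof cases
        case 1
        then obtain v w where "v \<in> {5..n}" "w \<in> {5..n}" "e = {v, \<alpha> v}" "f = {w, \<beta> w}"
          by blast
        then show ?thesis
          using HV zef by simp
      next
        case 2
        then obtain v x y where "v \<in> {5..n}" "x \<in> {5..n}" "y \<in> {5..n}" "\<alpha> x = \<alpha> y" "\<beta> x = \<beta> y"
            "\<tau> y = Suc (\<tau> x)" "e = {v, \<alpha> v}" "f = {x, y}"
          by blast
        then show ?thesis
          using HP zef by simp
      next
        case 3
        then obtain v x y where "v \<in> {5..n}" "x \<in> {5..n}" "y \<in> {5..n}" "\<alpha> x = \<alpha> y" "\<beta> x = \<beta> y"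
            "\<tau> y = Suc (\<tau> x)" "e = {v, \<beta> v}" "f = {x, y}"
          by blast
        then show ?thesis
          using VP zef by simp
      qed
    qed
    consider "e \<in> ?H" "f \<in> ?H" | "e \<in> ?V" "f \<in> ?V" | "e \<in> ?P" "f \<in> ?P"
      | "e \<in> ?H \<and> f \<in> ?V \<or> (e \<in> ?H \<or> e \<in> ?V) \<and> f \<in> ?P"
      | "f \<in> ?H \<and> e \<in> ?V \<or> (f \<in> ?H \<or> f \<in> ?V) \<and> e \<in> ?P"
      using crossing(1,2) unfolding Un_iff by argo
    then show ?thesis
    proof cases
      case 1
      then obtain v w where "v \<in> {5..n}" "w \<in> {5..n}" "e = {v, \<alpha> v}" "f = {w, \<alpha> w}"
        by blast
      then show ?thesis
        using HH crossing(3-5) by simp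
    next
      case 2
      then obtain v w where "v \<in> {5..n}" "w \<in> {5..n}" "e = {v, \<beta> v}" "f = {w, \<beta> w}"
        by blast
      then show ?thesis
        using VV crossing(3-5) by simp
    next
      case 3
      then obtain v w x y where "v \<in> {5..n}" "w \<in> {5..n}" "\<alpha> v = \<alpha> w" "\<beta> v = \<beta> w" "\<tau> w = Suc (\<tau> v)"
          "x \<in> {5..n}" "y \<in> {5..n}" "\<alpha> x = \<alpha> y" "\<beta> x = \<beta> y" "\<tau> y = Suc (\<tau> x)"
          "e = {v, w}" "f = {x, y}"
        by blast
      then show ?thesis
        using PP crossing(3-5) by simp
    next
      case 4
      then show ?thesis
        using cases crossing(4,5) by simp
    next
      case 5
      then have "z \<in> pos ` (f \<inter> e)"
        using cases crossing(4,5) by simp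
      then show ?thesis
        by (simp add: Int_commute)
    qed
  qed
  have not_axis: "Re (pos v) \<noteq> 0" "Im (pos v) \<noteq> 0" if "v \<in> {5..n}" for v
    using \<tau>(2)[OF that] sr[of v] by (auto simp: posW[OF that])
  have hub_inj: "h = h'" if "h \<in> {1..4}" "h' \<in> {1..4}" "pos h = pos h'" for h h'
  proof -
    have "h \<in> {1, 2, 3, 4}" "h' \<in> {1, 2, 3, 4}"
      using that by auto
    then show ?thesis
      using that(3) by (auto simp: pos_def complex_eq_iff)
  qed
  have hub_axis: "Re (pos h) = 0 \<or> Im (pos h) = 0" if "h \<in> {1..4}" for h
  proof -
    have "h \<in> {1, 2, 3, 4}"
      using that by auto
    then show ?thesis
      by (auto simp: pos_def)
  qed
  have hub_vertex: "h \<in> e" if h: "h \<in> {1..4}" and e: "e \<in> ?H \<union> ?V \<union> ?P" and he: "pos h \<in> convex hull (pos ` e)" for h e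
  proof -
    have hubs: "\<alpha> v \<in> {1..4}" "\<beta> v \<in> {1..4}" for v
      using \<alpha>[of v] \<beta>[of v] by auto
    consider v where "v \<in> {5..n}" "e = {v, \<alpha> v}" | v where "v \<in> {5..n}" "e = {v, \<beta> v}"
      | x y where "x \<in> {5..n}" "y \<in> {5..n}" "\<alpha> x = \<alpha> y" "\<beta> x = \<beta> y" "\<tau> y = Suc (\<tau> x)" "e = {x, y}"
      using e by blast
    then show ?thesis
    proof cases
      case 1
      then have "pos h = pos (\<alpha> v)"
        using H[of v "pos h"] he hub_axis[OF h] by auto
      then show ?thesis
        using hub_inj[OF h hubs(1)] 1 by blast
    next
      case 2
      then have "pos h = pos (\<beta> v)"
        using V[of v "pos h"] he hub_axis[OF h] by auto
      then show ?thesis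
        using hub_inj[OF h hubs(2)] 2 by blast
    next
      case 3
      then show ?thesis
        using P[OF 3(1-5), of "pos h"] he hub_axis[OF h] by auto
    qed
  qed
  have inj: "inj_on pos {1..n}"
  proof (rule inj_onI)
    fix v w
    assume vw: "v \<in> {1..n}" "w \<in> {1..n}" and eq: "pos v = pos w"
    consider "v \<in> {1..4}" "w \<in> {1..4}" | "v \<in> {1..4}" "w \<in> {5..n}" | "v \<in> {5..n}" "w \<in> {1..4}"
      | "v \<in> {5..n}" "w \<in> {5..n}"
      using vw by fastforce
    then show "v = w"
    proof cases
      case 1
      then show ?thesis
        using hub_inj eq by blast
    next
      case 2
      then show ?thesis
        using hub_axis[of v] not_axis[of w] eq by auto
    next
      case 3
      then show ?thesis
        using hub_axis[of w] not_axis[of v] eq by auto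
    next
      case 4
      then have "\<bar>Re (pos v)\<bar> = \<tau> v" "\<bar>Re (pos w)\<bar> = \<tau> w"
        using sr[of v] sr[of w] by (auto simp: posW)
      then show ?thesis
        using 4 eq \<tau>(1) by (auto dest: inj_onD)
    qed
  qed
  have vert: "u \<in> e" if "e \<in> ?H \<union> ?V \<union> ?P" "u \<in> {1..n}" "pos u \<in> convex hull (pos ` e)" for e u
  proof (cases "u \<in> {1..4}")
    case True
    then show ?thesis
      using hub_vertex that by blast
  next
    case False
    then have u: "u \<in> {5..n}"
      using that(2) by auto
    \<comment> \<open>A vertex \<open>u\<close> on another edge is treated as a crossing of that
      edge with the spoke of \<open>u\<close> itself. By \<open>cross\<close> it is then a common
      end of both, and injectivity of \<open>pos\<close> identifies that end with
      \<open>u\<close>.\<close>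
    then have f: "{u, \<alpha> u} \<in> ?H \<union> ?V \<union> ?P"
      by blast
    show ?thesis
    proof (cases "e = {u, \<alpha> u}")
      case False
      have "pos u \<in> convex hull (pos ` {u, \<alpha> u})"
        by (intro hull_inc imageI) simp
      then have "pos u \<in> pos ` (e \<inter> {u, \<alpha> u})"
        using cross[OF that(1) f False that(3)] by blast
      then obtain w where w: "w \<in> e" "w \<in> {u, \<alpha> u}" "pos u = pos w"
        by blast
      moreover have "\<alpha> u \<in> {1..n}"
        using \<alpha>[of u] n by auto
      ultimately show ?thesis
        using inj_onD[OF inj w(3)] that(2) by auto
    qed simp
  qed
  have edges: "e \<subseteq> {1..n} \<and> card e = 2" if e: "e \<in> ?H \<union> ?V \<union> ?P" for e
  proof -
    have h: "\<alpha> v \<in> {1..4}" "\<beta> v \<in> {1..4}" for v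
      using \<alpha>[of v] \<beta>[of v] by auto
    have "\<exists>v w. e = {v, w} \<and> v \<in> {1..n} \<and> w \<in> {1..n} \<and> v \<noteq> w"
    proof -
      consider v where "v \<in> {5..n}" "e = {v, \<alpha> v}" | v where "v \<in> {5..n}" "e = {v, \<beta> v}"
        | x y where "x \<in> {5..n}" "y \<in> {5..n}" "\<tau> y = Suc (\<tau> x)" "e = {x, y}"
        using e by blast
      then show ?thesis
      proof cases
        case (1 v)
        then show ?thesis
          using h(1)[of v] n by (intro exI[of _ v] exI[of _ "\<alpha> v"]) auto
      next
        case (2 v)
        then show ?thesis
          using h(2)[of v] n by (intro exI[of _ v] exI[of _ "\<beta> v"]) auto
      next
        case (3 x y)
        then show ?thesis
          by (intro exI[of _ x] exI[of _ y]) auto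
      qed
    qed
    then show ?thesis
      by auto
  qed
  show ?thesis
    using inj edges vert cross by (rule straight_line_planar)
qed

text \<open>A single numbering along \<open>concat L\<close> serves all colours: it is injective,
  and it increases by one along every path. Each colour class only uses some of the levels on its
  diagonal. Consecutive levels at the border of two paths may yield extra edges, hence the passage
  to a subgraph.\<close>

lemma hub_paths_planar:
  fixes \<alpha> \<beta> :: "nat \<Rightarrow> nat"
  assumes \<alpha>: "\<And>v. \<alpha> v \<in> {1, 2}" and \<beta>: "\<And>v. \<beta> v \<in> {3, 4}" and n: "4 \<le> n"
    and L: "distinct (concat L)" "set (concat L) = {5..n}"
    and mono: "\<And>p x y. p \<in> set L \<Longrightarrow> x \<in> set p \<Longrightarrow> y \<in> set p \<Longrightarrow> \<alpha> x = \<alpha> y \<and> \<beta> x = \<beta> y"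
  shows "planar {1..n} ({{v, \<alpha> v} | v. v \<in> {5..n}} \<union> {{v, \<beta> v} | v. v \<in> {5..n}} \<union> path_edges L)"
proof -
  let ?xs = "concat L"
  \<comment> \<open>The successor keeps the first vertex away from the origin, where the four
    diagonals meet.\<close>
  define \<tau> where "\<tau> v = Suc (inv_into {..<length ?xs} ((!) ?xs) v)" for v
  have bij: "bij_betw ((!) ?xs) {..<length ?xs} {5..n}"
    using bij_betw_nth[OF L(1), of "{..<length ?xs}" "{5..n}"] L(2) by simp
  then have \<tau>_nth: "\<tau> (?xs ! i) = Suc i" if "i < length ?xs" for i
    using that by (simp add: \<tau>_def bij_betw_inv_into_left)
  have inj: "inj_on \<tau> {5..n}"
    using bij_betw_inv_into[OF bij] unfolding \<tau>_def
    by (simp add: bij_betw_def inj_on_def)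
  have pos: "0 < \<tau> v" for v
    by (simp add: \<tau>_def)
  have sub: "path_edges L \<subseteq> {{v, w} | v w. v \<in> {5..n} \<and> w \<in> {5..n} \<and> \<alpha> v = \<alpha> w \<and> \<beta> v = \<beta> w
     \<and> \<tau> w = Suc (\<tau> v)}"
  proof
    fix e
    assume "e \<in> path_edges L"
    then obtain x y us vs where e: "e = {x, y}" and in_L: "us @ x # y # vs \<in> set L"
      unfolding path_edges_def by blast
    obtain L1 L2 where "L = L1 @ (us @ x # y # vs) # L2"
      using split_list[OF in_L] by blast
    then have xs: "?xs = (concat L1 @ us) @ x # y # (vs @ concat L2)"
      by simp
    define i where "i = length (concat L1 @ us)"
    have i: "Suc i < length ?xs" "?xs ! i = x" "?xs ! Suc i = y"
      unfolding xs i_def by (simp_all add: nth_append)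
    then have "\<tau> x = Suc i" "\<tau> y = Suc (Suc i)"
      using \<tau>_nth[of i] \<tau>_nth[of "Suc i"] by auto
    moreover have "x \<in> {5..n}" "y \<in> {5..n}"
      unfolding L(2)[symmetric] xs by simp_all
    moreover have "\<alpha> x = \<alpha> y \<and> \<beta> x = \<beta> y"
      by (rule mono[OF in_L]) simp_all
    ultimately show "e \<in> {{v, w} | v w. v \<in> {5..n} \<and> w \<in> {5..n} \<and> \<alpha> v = \<alpha> w \<and> \<beta> v = \<beta> w
        \<and> \<tau> w = Suc (\<tau> v)}"
      using e by force
  qed
  show ?thesis
    by (rule planar_subset[OF hub_graph_planar[of \<alpha> \<beta> n \<tau>, OF \<alpha> \<beta> n inj pos]]) (use sub in blast)
qed

section \<open>The strategy of Avoider\<close>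

lemma finite_complete_edges: "finite (complete_edges n)"
  unfolding complete_edges_def by (rule finite_subset[of _ "Pow {1..n}"]) auto

lemma card_complete_edges: "card (complete_edges n) = n choose 2"
  unfolding complete_edges_def using n_subsets[of "{1..n}" 2] by simp

lemma edge_in_complete_edges:
  "v \<in> {1..n} \<Longrightarrow> w \<in> {1..n} \<Longrightarrow> v \<noteq> w \<Longrightarrow> {v, w} \<in> complete_edges n"
  unfolding complete_edges_def by auto

lemma large_color_class:
  fixes f :: "'a \<Rightarrow> 'b"
  assumes "finite S" "finite C" "f ` S \<subseteq> C" "card C * s < card S"
  shows "\<exists>c. s < card {x \<in> S. f x = c}"
proof (rule ccontr)
  assume "\<not> ?thesis"
  then have le: "card {x \<in> S. f x = c} \<le> s" for c
    by (simp add: not_less)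
  have "S = (\<Union>c\<in>C. {x \<in> S. f x = c})"
    using assms(3) by blast
  then have "card S \<le> (\<Sum>c\<in>C. card {x \<in> S. f x = c})"
    using card_UN_le[OF assms(2), of "\<lambda>c. {x \<in> S. f x = c}"] by simp
  also have "\<dots> \<le> card C * s"
    using sum_bounded_above[of C "\<lambda>c. card {x \<in> S. f x = c}" s] le by simp
  finally show False
    using assms(4) by simp
qed

text \<open>Nonempty lists with disjoint entries cannot repeat. This links the number of paths in
  the invariant, a length, with the number used in counting, a cardinality.\<close>

lemma length_eq_card_paths:
  assumes "distinct (concat L)" "[] \<notin> set L"
  shows "card (set L) = length L"
  using assms distinct_card[of L] by (simp add: distinct_concat_iff removeAll_id)

text \<open>The pairs \<open>H v\<close> and \<open>V v\<close> are disjoint because hubs are at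
  most 4 and the other vertices at least 5. The edge that Avoider obtains from a pair defines
  \<open>\<alpha> v\<close> or \<open>\<beta> v\<close>.\<close>

lemma spokes_phase:
  assumes \<sigma>: "enforcer_strategy (complete_edges n) \<sigma>" and n: "4 \<le> n"
    and big: "4 * (n - 4) < n choose 2"
  shows "\<exists>p \<alpha> \<beta>. partial_play (complete_edges n) \<sigma> p \<and> length p = 2 * (2 * (n - 4))
    \<and> (\<forall>v. \<alpha> v \<in> {1, 2 :: nat}) \<and> (\<forall>v. \<beta> v \<in> {3, 4 :: nat})
    \<and> avoider_claims (2 * (n - 4)) p \<subseteq> {{v, \<alpha> v} | v. v \<in> {5..n}} \<union> {{v, \<beta> v} | v. v \<in> {5..n}}"
proof -
  define H where "H v = {{v, 1}, {v, 2 :: nat}}" for v :: nat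
  define V where "V v = {{v, 3}, {v, 4 :: nat}}" for v :: nat
  define Q where "Q = H ` {5..n} \<union> V ` {5..n}"
  have mem: "e \<in> H v \<longleftrightarrow> e = {v, 1} \<or> e = {v, 2}" "e \<in> V v \<longleftrightarrow> e = {v, 3} \<or> e = {v, 4}" for e v
    by (simp_all add: H_def V_def)
  have subH: "v \<in> e \<and> e \<subseteq> {v, 1, 2}" if "e \<in> H v" for e v
    using that unfolding mem by blast
  have subV: "v \<in> e \<and> e \<subseteq> {v, 3, 4} \<and> (3 \<in> e \<or> 4 \<in> e)" if "e \<in> V v" for e v
    using that unfolding mem by blast
  have Hdis: "v = w" if "v \<in> {5..n}" "w \<in> {5..n}" "e \<in> H v" "e \<in> H w" for e v w
  proof -
    have "v \<in> {w, 1, 2}"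
      using subH[OF that(3)] subH[OF that(4)] by blast
    then show ?thesis
      using that(1) by auto
  qed
  have Vdis: "v = w" if "v \<in> {5..n}" "w \<in> {5..n}" "e \<in> V v" "e \<in> V w" for e v w
  proof -
    have "v \<in> {w, 3, 4}"
      using subV[OF that(3)] subV[OF that(4)] by blast
    then show ?thesis
      using that(1) by auto
  qed
  have HVdis: "e \<notin> V w" if "v \<in> {5..n}" "w \<in> {5..n}" "e \<in> H v" for e v w
  proof
    assume "e \<in> V w"
    then have "3 \<in> {v, 1, 2} \<or> 4 \<in> {v, 1, 2}"
      using subH[OF that(3)] subV by blast
    then show False
      using that(1) by auto
  qed
  have nonempty: "{v, 1} \<in> H v" "{v, 3} \<in> V v" for v
    by (simp_all add: mem)
  have "inj_on H {5..n}" "inj_on V {5..n}"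
    using Hdis Vdis nonempty by (metis inj_onI)+
  moreover have "H ` {5..n} \<inter> V ` {5..n} = {}"
  proof (rule equals0I)
    fix q
    assume "q \<in> H ` {5..n} \<inter> V ` {5..n}"
    then obtain v w where "v \<in> {5..n}" "w \<in> {5..n}" "H v = V w"
      by (auto simp del: atLeastAtMost_iff)
    then show False
      using HVdis[of v w "{v, 1}"] nonempty(1)[of v] by simp
  qed
  ultimately have cardQ: "card Q = 2 * (n - 4)"
    unfolding Q_def using n by (simp add: card_Un_disjoint card_image)
  have dis: "disjoint Q"
  proof (rule disjointI)
    fix q q'
    assume "q \<in> Q" "q' \<in> Q" and ne: "q \<noteq> q'"
    then consider v w where "v \<in> {5..n}" "w \<in> {5..n}" "q = H v" "q' = H w"
      | v w where "v \<in> {5..n}" "w \<in> {5..n}" "q = H v" "q' = V w"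
      | v w where "v \<in> {5..n}" "w \<in> {5..n}" "q = V v" "q' = H w"
      | v w where "v \<in> {5..n}" "w \<in> {5..n}" "q = V v" "q' = V w"
      unfolding Q_def by blast
    then show "q \<inter> q' = {}"
    proof cases
      case (1 v w)
      then show ?thesis
        using ne Hdis[of v w] by auto
    next
      case (2 v w)
      then show ?thesis
        using HVdis[of v w] by auto
    next
      case (3 v w)
      then show ?thesis
        using HVdis[of w v] by auto
    next
      case (4 v w)
      then show ?thesis
        using ne Vdis[of v w] by auto
    qed
  qed
  have two: "card q = 2" if "q \<in> Q" for q
    using that by (auto simp: Q_def H_def V_def doubleton_eq_iff)
  have sub: "\<Union>Q \<subseteq> complete_edges n"
    using n by (auto simp: Q_def mem intro!: edge_in_complete_edges)
  have finQ: "finite Q" and bigQ: "2 * card Q < card (complete_edges n)"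
    using big cardQ by (simp_all add: Q_def card_complete_edges)
  obtain p where p: "partial_play (complete_edges n) \<sigma> p" "length p = 2 * card Q"
    "avoider_claims (card Q) p \<subseteq> \<Union>Q" "\<And>q. q \<in> Q \<Longrightarrow> is_singleton (avoider_claims (card Q) p \<inter> q)"
    using pairing_strategy[OF \<sigma> finQ sub dis two bigQ] by blast
  let ?A = "avoider_claims (card Q) p"
  \<comment> \<open>Outside \<open>{5..n}\<close> any hub is allowed, so that
    \<open>\<alpha>\<close> takes a value in \<open>{1, 2}\<close> everywhere, as the drawing lemmas
    demand.\<close>
  have "\<exists>h. h \<in> {1, 2} \<and> (v \<in> {5..n} \<longrightarrow> ?A \<inter> H v \<subseteq> {{v, h}})" for v
  proof (cases "v \<in> {5..n}")
    case True
    then have "is_singleton (?A \<inter> H v)"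
      by (intro p(4)) (simp add: Q_def)
    then obtain e where e: "?A \<inter> H v = {e}"
      by (rule is_singletonE)
    then have "e \<in> H v"
      by blast
    then obtain h where "h \<in> {1, 2}" "e = {v, h}"
      unfolding mem by blast
    then show ?thesis
      using e by (intro exI[of _ h]) simp
  qed auto
  then obtain \<alpha> where \<alpha>: "\<And>v. \<alpha> v \<in> {1, 2}" "\<And>v. v \<in> {5..n} \<Longrightarrow> ?A \<inter> H v \<subseteq> {{v, \<alpha> v}}"
    by metis
  have "\<exists>h. h \<in> {3, 4} \<and> (v \<in> {5..n} \<longrightarrow> ?A \<inter> V v \<subseteq> {{v, h}})" for v
  proof (cases "v \<in> {5..n}")
    case True
    then have "is_singleton (?A \<inter> V v)"
      by (intro p(4)) (simp add: Q_def)
    then obtain e where e: "?A \<inter> V v = {e}"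
      by (rule is_singletonE)
    then have "e \<in> V v"
      by blast
    then obtain h where "h \<in> {3, 4}" "e = {v, h}"
      unfolding mem by blast
    then show ?thesis
      using e by (intro exI[of _ h]) simp
  qed auto
  then obtain \<beta> where \<beta>: "\<And>v. \<beta> v \<in> {3, 4}" "\<And>v. v \<in> {5..n} \<Longrightarrow> ?A \<inter> V v \<subseteq> {{v, \<beta> v}}"
    by metis
  have "?A \<subseteq> {{v, \<alpha> v} | v. v \<in> {5..n}} \<union> {{v, \<beta> v} | v. v \<in> {5..n}}"
  proof
    fix e
    assume e: "e \<in> ?A"
    then consider v where "v \<in> {5..n}" "e \<in> H v" | v where "v \<in> {5..n}" "e \<in> V v"
      using p(3) unfolding Q_def by blast
    then show "e \<in> {{v, \<alpha> v} | v. v \<in> {5..n}} \<union> {{v, \<beta> v} | v. v \<in> {5..n}}"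
      by cases (use e \<alpha>(2) \<beta>(2) in blast)+
  qed
  then show ?thesis
    using p(1,2) \<alpha>(1) \<beta>(1) unfolding cardQ by (intro exI conjI allI) auto
qed

text \<open>The spokes take \<open>2 * (n - 4)\<close> rounds. Each later round joins two of the
  \<open>n - 4\<close> initial one-vertex paths or their successors, and joining goes on until
  \<open>4 * s\<close> paths remain. The bound \<open>6 * n < n choose 2\<close> guarantees that
  Enforcer can reply throughout.\<close>

lemma avoider_stays_planar:
  assumes \<sigma>: "enforcer_strategy (complete_edges n) \<sigma>" and n: "4 \<le> n"
    and s: "12 * n \<le> s * s" "4 * s \<le> n - 4" and big: "6 * n < n choose 2"
  shows "\<exists>p. complete_play (complete_edges n) \<sigma> p
    \<and> planar {1..n} (avoider_claims (3 * (n - 4) - 4 * s) p)"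
proof -
  have small: "4 * (n - 4) < n choose 2"
    using big by simp
  obtain p0 \<alpha> \<beta> where *: "partial_play (complete_edges n) \<sigma> p0 \<and> length p0 = 2 * (2 * (n - 4))
    \<and> (\<forall>v. \<alpha> v \<in> {1, 2}) \<and> (\<forall>v. \<beta> v \<in> {3, 4})
    \<and> avoider_claims (2 * (n - 4)) p0 \<subseteq> {{v, \<alpha> v} | v. v \<in> {5..n}} \<union> {{v, \<beta> v} | v. v \<in> {5..n}}"
    using spokes_phase[OF \<sigma> n small] by (elim exE)
  then have p0: "partial_play (complete_edges n) \<sigma> p0" "length p0 = 2 * (2 * (n - 4))"
    and p0A: "avoider_claims (2 * (n - 4)) p0 \<subseteq> {{v, \<alpha> v} | v. v \<in> {5..n}} \<union> {{v, \<beta> v} | v. v \<in> {5..n}}"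
    by blast+
  have \<alpha>: "\<And>v. \<alpha> v \<in> {1, 2}" and \<beta>: "\<And>v. \<beta> v \<in> {3, 4}"
    using * by blast+
  let ?S = "{{v, \<alpha> v} | v. v \<in> {5..n}} \<union> {{v, \<beta> v} | v. v \<in> {5..n}}"
  have "\<exists>p L. partial_play (complete_edges n) \<sigma> p \<and> length p = 2 * (2 * (n - 4) + j)
      \<and> distinct (concat L) \<and> [] \<notin> set L \<and> set (concat L) = {5..n} \<and> length L = n - 4 - j
      \<and> (\<forall>p\<in>set L. \<forall>x\<in>set p. \<forall>y\<in>set p. \<alpha> x = \<alpha> y \<and> \<beta> x = \<beta> y)
      \<and> avoider_claims (2 * (n - 4) + j) p \<subseteq> ?S \<union> path_edges L"
    if "j \<le> n - 4 - 4 * s" for j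
    using that
  proof (induction j)
    case 0
    show ?case
    proof (intro exI conjI)
      let ?L = "map (\<lambda>v. [v]) [5..<Suc n]"
      show "partial_play (complete_edges n) \<sigma> p0" "length p0 = 2 * (2 * (n - 4) + 0)"
        using p0 by auto
      show "distinct (concat ?L)" "set (concat ?L) = {5..n}" "[] \<notin> set ?L" "length ?L = n - 4 - 0"
        using n by auto
      show "\<forall>p\<in>set ?L. \<forall>x\<in>set p. \<forall>y\<in>set p. \<alpha> x = \<alpha> y \<and> \<beta> x = \<beta> y"
        by auto
      show "avoider_claims (2 * (n - 4) + 0) p0 \<subseteq> ?S \<union> path_edges ?L"
        using p0A by auto
    qed
  next
    case (Suc j)
    from Suc.IH[OF Suc_leD[OF Suc.prems]]
    obtain p L where p: "partial_play (complete_edges n) \<sigma> p" "length p = 2 * (2 * (n - 4) + j)"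
      and L: "distinct (concat L)" "[] \<notin> set L" "set (concat L) = {5..n}" "length L = n - 4 - j"
      and mono: "\<forall>p\<in>set L. \<forall>x\<in>set p. \<forall>y\<in>set p. \<alpha> x = \<alpha> y \<and> \<beta> x = \<beta> y"
      and A: "avoider_claims (2 * (n - 4) + j) p \<subseteq> ?S \<union> path_edges L"
      by blast
    define color where "color r = (\<alpha> (hd r), \<beta> (hd r))" for r
    have colors: "finite ({1, 2 :: nat} \<times> {3, 4 :: nat})" "color ` set L \<subseteq> {1, 2} \<times> {3, 4}"
      using \<alpha> \<beta> unfolding color_def by blast+
    \<comment> \<open>Before this join more than \<open>4 * s\<close> paths are left, so one of the
      four colours has more than \<open>s\<close> of them.\<close>
    have "card ({1, 2 :: nat} \<times> {3, 4 :: nat}) * s < card (set L)"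
      using Suc.prems L(4) length_eq_card_paths[OF L(1,2)] by simp
    then obtain c where c: "s < card {r \<in> set L. color r = c}"
      using large_color_class[OF List.finite_set colors] by blast
    define C where "C = {r \<in> set L. color r = c}"
    have "length p \<le> 6 * n"
      using p(2) Suc.prems by simp
    then have cardp: "card (set p) \<le> 6 * n"
      using card_length order_trans by blast
    have "s * s < (s + 1) * s"
      using s(1) n by (cases s) auto
    \<comment> \<open>At most \<open>6 * n\<close> edges are claimed, so twice their number is at
      most \<open>12 * n\<close>, hence at most \<open>s * s\<close>, which is below the number of
      ordered pairs of paths in \<open>C\<close>.\<close>
    also have "\<dots> \<le> card C * (card C - 1)"
      using c by (intro mult_mono) (auto simp: C_def)
    finally have "2 * card (set p) < card C * (card C - 1)"
      using s(1) cardp by linarith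
    then obtain q r where qr: "q \<in> C" "r \<in> C" "q \<noteq> r" "{last q, hd r} \<notin> set p"
      using exists_free_join[of L C "set p"] L by (auto simp: C_def)
    have qrL: "q \<in> set L" "r \<in> set L" and col: "color q = color r"
      using qr by (auto simp: C_def)
    have "q \<noteq> []" "r \<noteq> []"
      using qrL L(2) by auto
    then have ends: "last q \<in> set q" "hd q \<in> set q" "hd r \<in> set r"
      by auto
    have "set q \<inter> set r = {}"
      using L(1) qrL qr(3) unfolding distinct_concat_iff by blast
    then have "last q \<noteq> hd r"
      using ends(1,3) by (metis disjoint_iff)
    moreover have in_W: "x \<in> {5..n}" if "x \<in> set q \<or> x \<in> set r" for x
      unfolding L(3)[symmetric] set_concat using that qrL by blast
    moreover have "last q \<in> {1..n}" "hd r \<in> {1..n}"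
      using in_W[of "last q"] in_W[of "hd r"] ends by simp_all
    ultimately have y: "{last q, hd r} \<in> complete_edges n - set p"
      using edge_in_complete_edges qr(4) by simp
    have "2 * (2 * (n - 4) + j) + 1 < card (complete_edges n)"
    proof -
      have "2 * (2 * (n - 4) + j) + 1 \<le> 6 * n"
        using Suc.prems by simp
      then show ?thesis
        using big unfolding card_complete_edges by (rule le_less_trans)
    qed
    then obtain z where z: "partial_play (complete_edges n) \<sigma> (p @ [{last q, hd r}, z])"
      using partial_play_round[OF \<sigma> p y] by blast
    obtain L' where L': "length L = Suc (length L')" "distinct (concat L')" "[] \<notin> set L'"
      "set (concat L') = set (concat L)" "set L' \<subseteq> insert (q @ r) (set L)"
      "insert {last q, hd r} (path_edges L) \<subseteq> path_edges L'"
      using join_paths[OF L(1,2) qrL qr(3)] by blast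
    have same: "\<alpha> x = \<alpha> (hd q) \<and> \<beta> x = \<beta> (hd q)" if x: "x \<in> set q \<or> x \<in> set r" for x
    proof (cases "x \<in> set q")
      case True
      then show ?thesis
        using mono qrL(1) ends(2) by blast
    next
      case False
      then have "\<alpha> x = \<alpha> (hd r) \<and> \<beta> x = \<beta> (hd r)"
        using mono qrL(2) ends(3) x by blast
      then show ?thesis
        using col by (simp add: color_def)
    qed
    have mono': "\<forall>p\<in>set L'. \<forall>x\<in>set p. \<forall>y\<in>set p. \<alpha> x = \<alpha> y \<and> \<beta> x = \<beta> y"
    proof (intro ballI)
      fix t x y
      assume t: "t \<in> set L'" "x \<in> set t" "y \<in> set t"
      show "\<alpha> x = \<alpha> y \<and> \<beta> x = \<beta> y"
      proof (cases "t = q @ r")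
        case True
        then show ?thesis
          using t(2,3) same[of x] same[of y] by simp
      next
        case False
        then have "t \<in> set L"
          using t(1) L'(5) by blast
        then show ?thesis
          using mono t(2,3) by blast
      qed
    qed
    have "avoider_claims (Suc (2 * (n - 4) + j)) (p @ [{last q, hd r}, z])
        = insert {last q, hd r} (avoider_claims (2 * (n - 4) + j) p)"
      by (rule avoider_claims_round) (rule p(2))
    then have "avoider_claims (2 * (n - 4) + Suc j) (p @ [{last q, hd r}, z]) \<subseteq> ?S \<union> path_edges L'"
      using A L'(6) by auto
    moreover have "set (concat L') = {5..n}" "length L' = n - 4 - Suc j"
      using L' L by simp_all
    moreover have "length (p @ [{last q, hd r}, z]) = 2 * (2 * (n - 4) + Suc j)"
      using p(2) by simp
    ultimately show ?case
      using z L'(2,3) mono' by blast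
  qed
  from this[OF order_refl] obtain p L where p: "partial_play (complete_edges n) \<sigma> p"
      "length p = 2 * (2 * (n - 4) + (n - 4 - 4 * s))"
    and L: "distinct (concat L)" "set (concat L) = {5..n}"
      "\<forall>p\<in>set L. \<forall>x\<in>set p. \<forall>y\<in>set p. \<alpha> x = \<alpha> y \<and> \<beta> x = \<beta> y"
    and A: "avoider_claims (2 * (n - 4) + (n - 4 - 4 * s)) p \<subseteq> ?S \<union> path_edges L"
    by blast
  \<comment> \<open>Subtraction of naturals is truncated; \<open>4 * s \<le> n - 4\<close> makes
    this regrouping exact.\<close>
  have T: "2 * (n - 4) + (n - 4 - 4 * s) = 3 * (n - 4) - 4 * s"
    using s(2) by simp
  obtain r where r: "complete_play (complete_edges n) \<sigma> (p @ r)"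
    using partial_play_complete[OF \<sigma> finite_complete_edges p(1)] by blast
  have "planar {1..n} (?S \<union> path_edges L)"
    by (rule hub_paths_planar[of \<alpha> \<beta> n L, OF \<alpha> \<beta> n L(1,2)]) (use L(3) in blast)
  then have "planar {1..n} (avoider_claims (3 * (n - 4) - 4 * s) p)"
    using A unfolding T by (rule planar_subset)
  then show ?thesis
    using r avoider_claims_append[of "3 * (n - 4) - 4 * s" p r] p(2) T by auto
qed

text \<open>Claims grow with the number of moves and subgraphs of planar graphs are planar, so a
  planar position after \<open>T\<close> moves excludes a win within any \<open>t \<le> T\<close>.
  Every admissible \<open>t\<close> is then at least \<open>Suc T\<close>, and so is the infimum,
  also when it is taken over the empty set.\<close>

lemma tau_E_NP_greater:
  assumes T: "\<And>\<sigma>. enforcer_strategy (complete_edges n) \<sigma> \<Longrightarrow>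
    \<exists>p. complete_play (complete_edges n) \<sigma> p \<and> planar {1..n} (avoider_claims T p)"
  shows "enat T < tau_E (complete_edges n) (NP n)"
proof -
  have "enat (Suc T) \<le> enat t" if win: "enforcer_wins_within (complete_edges n) (NP n) t" for t
  proof (rule ccontr)
    assume "\<not> enat (Suc T) \<le> enat t"
    then have "t \<le> T"
      by simp
    obtain \<sigma> where \<sigma>: "enforcer_strategy (complete_edges n) \<sigma>"
      "\<And>p. complete_play (complete_edges n) \<sigma> p \<Longrightarrow> \<exists>A\<in>NP n. A \<subseteq> avoider_claims t p"
      using win unfolding enforcer_wins_within_def by blast
    obtain p where p: "complete_play (complete_edges n) \<sigma> p" "planar {1..n} (avoider_claims T p)"
      using T[OF \<sigma>(1)] by blast
    obtain A where A: "A \<in> NP n" "A \<subseteq> avoider_claims t p"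
      using \<sigma>(2)[OF p(1)] by blast
    have "planar {1..n} A"
      by (rule planar_subset[OF p(2) order_trans[OF A(2) avoider_claims_mono[OF \<open>t \<le> T\<close>]]])
    then show False
      using A(1) by (simp add: NP_def)
  qed
  then have "enat (Suc T) \<le> tau_E (complete_edges n) (NP n)"
    unfolding tau_E_def by (intro INF_greatest) simp
  then show ?thesis
    by (metis Suc_ile_eq)
qed

section \<open>Choice of the constants\<close>

theorem theorem1:
  "\<exists>N::nat. \<forall>n\<ge>N.
     ereal_of_enat (tau_E (complete_edges n) (NP n)) > ereal (3 * real n - 28 * sqrt (real n))"
proof (intro exI allI impI)
  fix n :: nat
  assume n: "400 \<le> n"
  \<comment> \<open>The least natural number with \<open>12 * n \<le> s * s\<close>.\<close>
  define s where "s = nat \<lceil>sqrt (12 * real n)\<rceil>"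
  have s: "sqrt (12 * n) \<le> s" "s < sqrt (12 * n) + 1"
    unfolding s_def by (simp_all add: real_nat_ceiling_ge) (linarith)
  have "12 * real n \<le> real s * real s"
    using power_mono[OF s(1), of 2] by (simp add: power2_eq_square)
  then have s1: "12 * n \<le> s * s"
    by (metis of_nat_le_iff of_nat_mult of_nat_numeral)
  have root: "20 \<le> sqrt n"
    using n by (intro real_le_rsqrt) simp
  \<comment> \<open>Since 12 < 49/4, this gives \<open>4 * s \<le> 14 * sqrt n + 4\<close>. The
    total loss against \<open>3 * n\<close> is then at most \<open>14 * sqrt n + 16\<close>, well
    within \<open>28 * sqrt n\<close>.\<close>
  have "sqrt (12 * n) \<le> sqrt ((7 / 2)\<^sup>2 * n)"
    by (simp add: power2_eq_square)
  also have "\<dots> = 7 / 2 * sqrt n"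
    by (simp add: real_sqrt_mult)
  finally have s_le: "s \<le> 7 / 2 * sqrt n + 1"
    using s(2) by simp
  have "20 * sqrt n \<le> sqrt n * sqrt n"
    using root by (intro mult_right_mono) auto
  then have s2: "4 * s \<le> n - 4"
    using s_le root n by simp
  have "n * 14 \<le> n * (n - 1)"
    using n by (intro mult_le_mono2) simp
  \<comment> \<open>The summand 2 turns the quotient into \<open>6 * n + 1\<close>, which makes the
    inequality with the binomial coefficient strict.\<close>
  then have "(12 * n + 2) div 2 \<le> n * (n - 1) div 2"
    using n by (intro div_le_mono) linarith
  then have big: "6 * n < n choose 2"
    unfolding choose_two by simp
  have "enat (3 * (n - 4) - 4 * s) < tau_E (complete_edges n) (NP n)"
    using avoider_stays_planar[OF _ _ s1 s2 big] n by (intro tau_E_NP_greater) auto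
  then have "ereal_of_enat (enat (3 * (n - 4) - 4 * s)) < ereal_of_enat (tau_E (complete_edges n) (NP n))"
    by (simp only: ereal_of_enat_less_iff)
  moreover have "3 * real n - 28 * sqrt n \<le> real (3 * (n - 4) - 4 * s)"
    using s_le s2 root n by (simp add: of_nat_diff)
  ultimately show "ereal_of_enat (tau_E (complete_edges n) (NP n)) > ereal (3 * real n - 28 * sqrt n)"
    by (metis ereal_less_eq(3) ereal_of_enat_simps(1) order_le_less_trans)
qed

end
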